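(* Let $(X,r)$ be a solution of the Yang--Baxter equation such that its left brace structure $G(X,r)$ is a Dedekind left brace. Assume that $r(x,x)=(x,x)$ for every $x\in X$. Then $(X,r)$ is a twist solution, and $G(X,r)$ is an abelian left brace isomorphic to $\mathbb{Z}^X$, the free abelian group on $X$.
   Context: A left brace is a triple $(A,+,\cdot)$ such that $(A,+)$ is an abelian group, $(A,\cdot)$ is a group, and $a\cdot(b+c)=a\cdot b+a\cdot c-a$ for all $a,b,c\in A$. The two groups have the same identity $0$. Put $a\ast b=ab-a-b$ and $\lambda_a(b)=-a+ab$. A left brace is abelian if $a\ast b=0$ for all $a,b$ (so the two group structures coincide, and one calls the brace isomorphic to that common group). A non-empty subset is a subbrace if it is a subgroup for both operations; a subbrace $I$ is an ideal of $A$ if $a\ast x, x\ast a\in I$ for all $a\in A$, $x\in I$. $A$ is Dedekind if every subbrace of $A$ is an ideal of $A$. A solution of the Yang--Baxter equation is a pair $(X,r)$ with $X$ a set and $r\colon X\times X\to X\times X$, $r(x,y)=(\lambda_x(y),\rho_y(x))$, such that: $r_{12}r_{23}r_{12}=r_{23}r_{12}r_{23}$ on $X^3$, where $r_{12}=r\times\mathrm{id}_X$ and $r_{23}=\mathrm{id}_X\times r$; $r^2=\mathrm{id}_{X\times X}$ (involutive); all maps $\lambda_x,\rho_x\colon X\to X$ are bijective (non-degenerate). A twist solution is one with $r(x,y)=(y,x)$ for all $x,y\in X$. The structure group of $(X,r)$ is the group $G(X,r)$ with generators the elements of $X$ and relations $xy=\lambda_x(y)\rho_y(x)$ for all $x,y\in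 X$. The canonical map $\iota\colon X\to G(X,r)$ is injective. The left brace structure of $(X,r)$ is the standard left brace with multiplicative group $G(X,r)$, whose additive group is free abelian with basis $\iota(X)$ and for which $\lambda_{\iota(x)}(\iota(y))=\iota(\lambda_x(y))$ for all $x,y\in X$. *)

theory Defs
  imports "HOL-Algebra.Ring" "HOL-Algebra.Free_Abelian_Groups"
begin

section \<open>Left braces\<close>

text \<open>A left brace is carried by a record of type \<open>ring\<close>: \<open>add\<close>, \<open>zero\<close> are the
  additive group and \<open>mult\<close>, \<open>one\<close> the multiplicative group. That \<open>\<zero> = \<one>\<close> is a
  consequence of the axioms. No ring axiom beyond the additive group is used.\<close>

locale left_brace = abelian_group A + group A for A (structure) +
  assumes brace_distrib:
    "\<lbrakk>a \<in> carrier A; b \<in> carrier A; c \<in> carrier A\<rbrakk>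
      \<Longrightarrow> a \<otimes> (b \<oplus> c) = (a \<otimes> b) \<oplus> (a \<otimes> c) \<ominus> a"

definition star :: "('a, 'm) ring_scheme \<Rightarrow> 'a \<Rightarrow> 'a \<Rightarrow> 'a" where
  "star A a b = a \<otimes>\<^bsub>A\<^esub> b \<ominus>\<^bsub>A\<^esub> a \<ominus>\<^bsub>A\<^esub> b"

definition lam :: "('a, 'm) ring_scheme \<Rightarrow> 'a \<Rightarrow> 'a \<Rightarrow> 'a" where
  "lam A a b = (\<ominus>\<^bsub>A\<^esub> a) \<oplus>\<^bsub>A\<^esub> (a \<otimes>\<^bsub>A\<^esub> b)"

definition abelian_left_brace :: "('a, 'm) ring_scheme \<Rightarrow> bool" where
  "abelian_left_brace A \<longleftrightarrow>
     left_brace A \<and> (\<forall>a\<in>carrier A. \<forall>b\<in>carrier A. star A a b = \<zero>\<^bsub>A\<^esub>)"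

definition subbrace :: "'a set \<Rightarrow> ('a, 'm) ring_scheme \<Rightarrow> bool" where
  "subbrace S A \<longleftrightarrow> subgroup S (add_monoid A) \<and> subgroup S A"

definition brace_ideal :: "'a set \<Rightarrow> ('a, 'm) ring_scheme \<Rightarrow> bool" where
  "brace_ideal I A \<longleftrightarrow>
     subbrace I A \<and> (\<forall>a\<in>carrier A. \<forall>x\<in>I. star A a x \<in> I \<and> star A x a \<in> I)"

definition dedekind_left_brace :: "('a, 'm) ring_scheme \<Rightarrow> bool" where
  "dedekind_left_brace A \<longleftrightarrow> left_brace A \<and> (\<forall>S. subbrace S A \<longrightarrow> brace_ideal S A)"

definition brace_iso :: "('a, 'm) ring_scheme \<Rightarrow> ('b, 'n) ring_scheme \<Rightarrow> ('a \<Rightarrow> 'b) set" where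
  "brace_iso A B = iso (add_monoid A) (add_monoid B) \<inter> iso A B"

text \<open>An abelian group regarded as an abelian left brace, both operations being the
  given one.\<close>

definition trivial_brace :: "'a monoid \<Rightarrow> 'a ring" where
  "trivial_brace H =
     \<lparr>carrier = carrier H, monoid.mult = monoid.mult H, one = one H,
      ring.zero = one H, ring.add = monoid.mult H\<rparr>"

section \<open>Solutions of the Yang--Baxter equation\<close>

text \<open>Here \<open>r (x, y) = (sol_lam r x y, sol_rho r y x)\<close>.\<close>

definition sol_lam :: "('a \<times> 'a \<Rightarrow> 'a \<times> 'a) \<Rightarrow> 'a \<Rightarrow> 'a \<Rightarrow> 'a" where
  "sol_lam r x y = fst (r (x, y))"

definition sol_rho :: "('a \<times> 'a \<Rightarrow> 'a \<times> 'a) \<Rightarrow> 'a \<Rightarrow> 'a \<Rightarrow> 'a" where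
  "sol_rho r y x = snd (r (x, y))"

definition r12 :: "('a \<times> 'a \<Rightarrow> 'a \<times> 'a) \<Rightarrow> 'a \<times> 'a \<times> 'a \<Rightarrow> 'a \<times> 'a \<times> 'a" where
  "r12 r = (\<lambda>(x, y, z). (fst (r (x, y)), snd (r (x, y)), z))"

definition r23 :: "('a \<times> 'a \<Rightarrow> 'a \<times> 'a) \<Rightarrow> 'a \<times> 'a \<times> 'a \<Rightarrow> 'a \<times> 'a \<times> 'a" where
  "r23 r = (\<lambda>(x, y, z). (x, r (y, z)))"

definition ybe_solution :: "'a set \<Rightarrow> ('a \<times> 'a \<Rightarrow> 'a \<times> 'a) \<Rightarrow> bool" where
  "ybe_solution X r \<longleftrightarrow>
     (\<forall>p \<in> X \<times> X. r p \<in> X \<times> X) \<and>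
     (\<forall>t \<in> X \<times> X \<times> X. r12 r (r23 r (r12 r t)) = r23 r (r12 r (r23 r t))) \<and>
     (\<forall>p \<in> X \<times> X. r (r p) = p) \<and>
     (\<forall>x\<in>X. bij_betw (sol_lam r x) X X \<and> bij_betw (sol_rho r x) X X)"

definition twist_solution :: "'a set \<Rightarrow> ('a \<times> 'a \<Rightarrow> 'a \<times> 'a) \<Rightarrow> bool" where
  "twist_solution X r \<longleftrightarrow> ybe_solution X r \<and> (\<forall>x\<in>X. \<forall>y\<in>X. r (x, y) = (y, x))"

section \<open>Groups given by generators and relations\<close>

text \<open>A word is a list of letters \<open>(x, e)\<close>; \<open>(x, True)\<close> stands for the generator \<open>x\<close>
  and \<open>(x, False)\<close> for its inverse.\<close>

type_synonym 'a gword = "('a \<times> bool) list"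

definition words :: "'a set \<Rightarrow> 'a gword set" where
  "words X = lists (X \<times> UNIV)"

inductive word_eq :: "'a set \<Rightarrow> ('a gword \<times> 'a gword) set \<Rightarrow> 'a gword \<Rightarrow> 'a gword \<Rightarrow> bool"
  for X :: "'a set" and R :: "('a gword \<times> 'a gword) set" where
  refl: "w \<in> words X \<Longrightarrow> word_eq X R w w"
| sym: "word_eq X R v w \<Longrightarrow> word_eq X R w v"
| trans: "word_eq X R u v \<Longrightarrow> word_eq X R v w \<Longrightarrow> word_eq X R u w"
| cancel: "\<lbrakk>u \<in> words X; v \<in> words X; x \<in> X\<rbrakk>
            \<Longrightarrow> word_eq X R (u @ [(x, e), (x, \<not> e)] @ v) (u @ v)"
| relator: "\<lbrakk>u \<in> words X; v \<in> words X; (s, t) \<in> R; s \<in> words X; t \<in> words X\<rbrakk>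
            \<Longrightarrow> word_eq X R (u @ s @ v) (u @ t @ v)"

definition word_class :: "'a set \<Rightarrow> ('a gword \<times> 'a gword) set \<Rightarrow> 'a gword \<Rightarrow> 'a gword set" where
  "word_class X R w = {v. word_eq X R w v}"

definition presented_group :: "'a set \<Rightarrow> ('a gword \<times> 'a gword) set \<Rightarrow> 'a gword set monoid" where
  "presented_group X R =
     \<lparr>carrier = word_class X R ` words X,
      monoid.mult = (\<lambda>P Q. \<Union>u\<in>P. \<Union>v\<in>Q. word_class X R (u @ v)),
      one = word_class X R []\<rparr>"

lemma append_in_words [simp]: "u @ v \<in> words X \<longleftrightarrow> u \<in> words X \<and> v \<in> words X"
  by (auto simp: words_def)

lemma Nil_in_words [simp]: "[] \<in> words X"
  by (simp add: words_def)

lemma Cons_in_words [simp]: "p # v \<in> words X \<longleftrightarrow> fst p \<in> X \<and> v \<in> words X"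
  by (cases p) (auto simp: words_def)

lemma word_eq_words: "word_eq X R u v \<Longrightarrow> u \<in> words X \<and> v \<in> words X"
  by (induction rule: word_eq.induct) auto

lemma word_eq_append_right:
  assumes "word_eq X R u u'" "v \<in> words X" shows "word_eq X R (u @ v) (u' @ v)"
  using assms
proof (induction rule: word_eq.induct)
  case (cancel u w x e)
  then show ?case using word_eq.cancel[of u X "w @ v" x R e] by simp
next
  case (relator u w s t)
  then show ?case using word_eq.relator[of u X "w @ v" s t R] by simp
next
  case (trans u w z)
  then show ?case by (blast intro: word_eq.trans)
qed (simp_all add: word_eq.refl word_eq.sym)

lemma word_eq_append_left:
  assumes "word_eq X R u u'" "v \<in> words X" shows "word_eq X R (v @ u) (v @ u')"
  using assms
proof (induction rule: word_eq.induct)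
  case (cancel u w x e)
  then show ?case using word_eq.cancel[of "v @ u" X w x R e] by simp
next
  case (relator u w s t)
  then show ?case using word_eq.relator[of "v @ u" X w s t R] by simp
next
  case (trans u w z)
  then show ?case by (blast intro: word_eq.trans)
qed (simp_all add: word_eq.refl word_eq.sym)

lemma word_class_eq_iff:
  assumes "u \<in> words X"
  shows "word_class X R u = word_class X R v \<longleftrightarrow> word_eq X R u v"
proof
  assume "word_class X R u = word_class X R v"
  moreover have "u \<in> word_class X R u" using assms by (simp add: word_class_def word_eq.refl)
  ultimately have "word_eq X R v u" by (simp add: word_class_def)
  then show "word_eq X R u v" by (rule word_eq.sym)
next
  assume uv: "word_eq X R u v"
  have "word_eq X R u w \<longleftrightarrow> word_eq X R v w" for w
    using word_eq.trans[OF uv, of w] word_eq.trans[OF word_eq.sym[OF uv], of w] by (rule iffI[rotated])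
  then show "word_class X R u = word_class X R v" by (simp add: word_class_def)
qed

lemma presented_group_mult:
  assumes "u \<in> words X" "v \<in> words X"
  shows "word_class X R u \<otimes>\<^bsub>presented_group X R\<^esub> word_class X R v = word_class X R (u @ v)"
proof -
  have eq: "word_class X R (u' @ v') = word_class X R (u @ v)"
    if "u' \<in> word_class X R u" "v' \<in> word_class X R v" for u' v'
  proof -
    have uv: "word_eq X R u u'" "word_eq X R v v'"
      using that by (simp_all add: word_class_def)
    have "word_eq X R (u @ v) (u' @ v)"
      by (rule word_eq_append_right[OF uv(1) assms(2)])
    moreover have "word_eq X R (u' @ v) (u' @ v')"
      by (rule word_eq_append_left[OF uv(2)]) (use word_eq_words[OF uv(1)] in simp)
    ultimately have "word_eq X R (u @ v) (u' @ v')"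
      by (rule word_eq.trans)
    then show ?thesis using word_class_eq_iff[of "u @ v" X R "u' @ v'"] assms by simp
  qed
  have mem: "u \<in> word_class X R u" "v \<in> word_class X R v"
    using assms by (simp_all add: word_class_def word_eq.refl)
  have "(\<Union>u'\<in>word_class X R u. \<Union>v'\<in>word_class X R v. word_class X R (u' @ v'))
      = (\<Union>u'\<in>word_class X R u. \<Union>v'\<in>word_class X R v. word_class X R (u @ v))"
    by (simp add: eq)
  also have "\<dots> = word_class X R (u @ v)" using mem by blast
  finally show ?thesis by (simp add: presented_group_def)
qed

lemma word_eq_inverse:
  assumes "w \<in> words X"
  shows "word_eq X R (map (apsnd Not) (rev w) @ w) []"
  using assms
proof (induction w)
  case (Cons p w)
  let ?w' = "map (apsnd Not) (rev w)"
  have w': "?w' \<in> words X" using Cons.prems by (auto simp: words_def in_lists_conv_set)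
  then have "word_eq X R (?w' @ [(fst p, \<not> snd p), (fst p, \<not> \<not> snd p)] @ w) (?w' @ w)"
    using Cons.prems by (intro word_eq.cancel) auto
  moreover have "word_eq X R (?w' @ w) []" using Cons by simp
  ultimately have "word_eq X R (?w' @ [(fst p, \<not> snd p), (fst p, \<not> \<not> snd p)] @ w) []"
    by (rule word_eq.trans)
  then show ?case by (cases p) simp
qed (auto intro: word_eq.refl)

lemma group_presented_group: "group (presented_group X R)"
proof (rule groupI)
  show "\<one>\<^bsub>presented_group X R\<^esub> \<in> carrier (presented_group X R)"
    by (auto simp: presented_group_def)
next
  fix P Q assume "P \<in> carrier (presented_group X R)" "Q \<in> carrier (presented_group X R)"
  then obtain u v where "u \<in> words X" "v \<in> words X" "P = word_class X R u" "Q = word_class X R v"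
    by (auto simp: presented_group_def)
  then show "P \<otimes>\<^bsub>presented_group X R\<^esub> Q \<in> carrier (presented_group X R)"
    using presented_group_mult[of u X v R] by (simp add: presented_group_def)
next
  fix P Q S
  assume "P \<in> carrier (presented_group X R)" "Q \<in> carrier (presented_group X R)"
    "S \<in> carrier (presented_group X R)"
  then obtain u v w where "u \<in> words X" "v \<in> words X" "w \<in> words X"
    "P = word_class X R u" "Q = word_class X R v" "S = word_class X R w"
    by (auto simp: presented_group_def)
  then show "P \<otimes>\<^bsub>presented_group X R\<^esub> Q \<otimes>\<^bsub>presented_group X R\<^esub> S =
      P \<otimes>\<^bsub>presented_group X R\<^esub> (Q \<otimes>\<^bsub>presented_group X R\<^esub> S)"
    by (simp add: presented_group_mult)
next
  fix P assume "P \<in> carrier (presented_group X R)"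
  then obtain u where u: "u \<in> words X" "P = word_class X R u"
    by (auto simp: presented_group_def)
  have one: "\<one>\<^bsub>presented_group X R\<^esub> = word_class X R []"
    by (simp add: presented_group_def)
  show "\<one>\<^bsub>presented_group X R\<^esub> \<otimes>\<^bsub>presented_group X R\<^esub> P = P"
    using u by (simp add: one presented_group_mult)
  let ?u' = "map (apsnd Not) (rev u)"
  have u': "?u' \<in> words X" using u by (auto simp: words_def in_lists_conv_set)
  have "word_class X R ?u' \<otimes>\<^bsub>presented_group X R\<^esub> P = \<one>\<^bsub>presented_group X R\<^esub>"
    using u u' word_eq_inverse[OF u(1), of R] word_class_eq_iff[of "?u' @ u" X R "[]"]
    by (simp add: one presented_group_mult)
  moreover have "word_class X R ?u' \<in> carrier (presented_group X R)"
    using u' by (simp add: presented_group_def)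
  ultimately show "\<exists>Q\<in>carrier (presented_group X R).
      Q \<otimes>\<^bsub>presented_group X R\<^esub> P = \<one>\<^bsub>presented_group X R\<^esub>" by blast
qed

section \<open>The structure group and the left brace structure of a solution\<close>

definition structure_relations ::
    "'a set \<Rightarrow> ('a \<times> 'a \<Rightarrow> 'a \<times> 'a) \<Rightarrow> ('a gword \<times> 'a gword) set" where
  "structure_relations X r =
     {([(x, True), (y, True)], [(sol_lam r x y, True), (sol_rho r y x, True)]) | x y.
        x \<in> X \<and> y \<in> X}"

definition structure_group :: "'a set \<Rightarrow> ('a \<times> 'a \<Rightarrow> 'a \<times> 'a) \<Rightarrow> 'a gword set monoid" where
  "structure_group X r = presented_group X (structure_relations X r)"

definition structure_iota :: "'a set \<Rightarrow> ('a \<times> 'a \<Rightarrow> 'a \<times> 'a) \<Rightarrow> 'a \<Rightarrow> 'a gword set" where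
  "structure_iota X r x = word_class X (structure_relations X r) [(x, True)]"

definition free_abelian_basis :: "('a \<Rightarrow> 'b) \<Rightarrow> 'a set \<Rightarrow> 'b monoid \<Rightarrow> bool" where
  "free_abelian_basis i X H \<longleftrightarrow>
     (\<exists>f \<in> iso (free_Abelian_group X) H. \<forall>x\<in>X. f (frag_of x) = i x)"

text \<open>\<open>is_structure_brace X r G\<close>: \<open>G\<close> is the left brace structure of \<open>(X, r)\<close>. The
  multiplicative group of \<open>G\<close> is literally \<open>structure_group X r\<close>. The remaining conditions
  determine the addition on the carrier: every \<open>lam G (structure_iota X r x)\<close> is fixed on an
  additive basis, hence so is the whole map \<open>lam G\<close>.\<close>

definition is_structure_brace ::
    "'a set \<Rightarrow> ('a \<times> 'a \<Rightarrow> 'a \<times> 'a) \<Rightarrow> 'a gword set ring \<Rightarrow> bool" where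
  "is_structure_brace X r G \<longleftrightarrow>
     left_brace G \<and>
     monoid.truncate G = structure_group X r \<and>
     free_abelian_basis (structure_iota X r) X (add_monoid G) \<and>
     (\<forall>x\<in>X. \<forall>y\<in>X. lam G (structure_iota X r x) (structure_iota X r y)
                      = structure_iota X r (sol_lam r x y))"

end

theory Submission
  imports Defs
begin

text \<open>The hypothesis \<open>r (x, x) = (x, x)\<close> says that each basis element \<open>x\<close> is fixed by its own
  \<open>\<lambda>\<^sub>x\<close>. A set of elements whose \<open>\<lambda>\<close>-maps fix the set pointwise spans, additively, a
  subbrace on which the two operations coincide (\<open>lam_trivial_on_generate\<close>,
  \<open>subbrace_if_lam_trivial\<close>). Applied to \<open>{x}\<close>, this makes the infinite cyclic group
  \<open>\<int>x\<close> a subbrace, hence an ideal because the brace is Dedekind. Ideals are stable under every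
  \<open>\<lambda>\<^sub>a\<close>, since \<open>\<lambda>\<^sub>a(x) = a \<ast> x + x\<close>; so \<open>\<lambda>\<^sub>y(x)\<close> lies in \<open>\<int>x\<close>. But \<open>\<lambda>\<^sub>y\<close> permutes the
  basis, and \<open>x\<close> is the only basis element in \<open>\<int>x\<close>
  (\<open>free_abelian_basis_in_generate\<close>). Hence \<open>\<lambda>\<^sub>y(x) = x\<close> for all \<open>x\<close> and \<open>y\<close>,
  and involutivity turns this into \<open>r (x, y) = (y, x)\<close>. The first observation, applied now to
  the whole basis, shows that the two operations coincide on the entire brace, whose additive group
  is free abelian on \<open>X\<close>.\<close>

section \<open>The lambda maps of a left brace\<close>

context left_brace
begin

lemma lam_closed [simp]: "\<lbrakk>a \<in> carrier A; b \<in> carrier A\<rbrakk> \<Longrightarrow> lam A a b \<in> carrier A"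
  by (simp add: lam_def)

lemma mult_eq_add_lam: "\<lbrakk>a \<in> carrier A; b \<in> carrier A\<rbrakk> \<Longrightarrow> a \<otimes> b = a \<oplus> lam A a b"
  by (simp add: lam_def a_assoc[symmetric] r_neg)

lemma star_eq_lam_minus:
  assumes "a \<in> carrier A" "b \<in> carrier A"
  shows "star A a b = lam A a b \<ominus> b"
  using assms by (simp add: star_def lam_def a_minus_def a_ac)

lemma eq_if_minus_eq_zero:
  assumes "a \<in> carrier A" "b \<in> carrier A" "a \<ominus> b = \<zero>"
  shows "a = b"
proof -
  have "a \<ominus> b \<oplus> b = a"
    using assms(1,2) by (simp add: a_minus_def a_assoc l_neg)
  then show ?thesis using assms(2) by (simp add: assms(3))
qed

lemma mult_zero_right:
  assumes a: "a \<in> carrier A"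
  shows "a \<otimes> \<zero> = a"
proof -
  have "a \<otimes> \<zero> \<oplus> (a \<otimes> \<zero> \<ominus> a) = a \<otimes> \<zero>"
    using brace_distrib[OF a zero_closed zero_closed, symmetric] a
    by (simp add: a_minus_def a_assoc)
  then have "a \<otimes> \<zero> \<ominus> a = \<zero>"
    using a by (subst (asm) add.l_cancel_one) simp_all
  then show ?thesis
    using a eq_if_minus_eq_zero by simp
qed

lemma zero_eq_one: "\<zero> = \<one>"
  using mult_zero_right[of \<one>] by simp

lemma lam_zero_left: "b \<in> carrier A \<Longrightarrow> lam A \<zero> b = b"
  using mult_eq_add_lam[of \<zero> b] l_one[of b] by (simp add: zero_eq_one[symmetric])

lemma lam_zero_right: "a \<in> carrier A \<Longrightarrow> lam A a \<zero> = \<zero>"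
  by (simp add: lam_def mult_zero_right l_neg)

lemma lam_add:
  assumes "a \<in> carrier A" "b \<in> carrier A" "c \<in> carrier A"
  shows "lam A a (b \<oplus> c) = lam A a b \<oplus> lam A a c"
  using assms by (simp add: lam_def brace_distrib a_minus_def a_assoc a_comm[of "a \<otimes> c" "\<ominus> a"])

lemma lam_neg:
  assumes "a \<in> carrier A" "b \<in> carrier A"
  shows "lam A a (\<ominus> b) = \<ominus> lam A a b"
proof -
  have "lam A a (\<ominus> b) \<oplus> lam A a b = \<zero>"
    using assms lam_add[of a "\<ominus> b" b] by (simp add: l_neg lam_zero_right)
  from minus_equality[OF this] show ?thesis using assms by simp
qed

text \<open>\<open>\<lambda>\<close> is an action of the multiplicative group: added to \<open>a b\<close>, either side gives
  \<open>a b c\<close>.\<close>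

lemma lam_mult:
  assumes "a \<in> carrier A" "b \<in> carrier A" "c \<in> carrier A"
  shows "lam A (a \<otimes> b) c = lam A a (lam A b c)"
proof -
  have "a \<otimes> b \<oplus> lam A (a \<otimes> b) c = a \<otimes> b \<oplus> lam A a (lam A b c)"
  proof -
    have "a \<otimes> b \<oplus> lam A (a \<otimes> b) c = a \<otimes> (b \<otimes> c)"
      using assms by (simp add: mult_eq_add_lam[symmetric] m_assoc)
    also have "\<dots> = a \<oplus> lam A a (b \<oplus> lam A b c)"
      using assms by (simp add: mult_eq_add_lam[of b c] mult_eq_add_lam[of a "b \<oplus> lam A b c"])
    also have "\<dots> = a \<otimes> b \<oplus> lam A a (lam A b c)"
      using assms by (simp add: lam_add a_assoc mult_eq_add_lam)
    finally show ?thesis .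
  qed
  then show ?thesis using assms by simp
qed

section \<open>Additive subgroups with trivial lambda action\<close>

lemma subgroup_lam_fixed:
  assumes "a \<in> carrier A"
  shows "subgroup {b \<in> carrier A. lam A a b = b} (add_monoid A)"
  by (rule add.subgroupI)
    (use assms in \<open>auto simp: lam_zero_right lam_add lam_neg a_inv_def[symmetric]\<close>)

text \<open>Because \<open>b c = b + \<lambda>\<^sub>b(c)\<close>, products of elements of \<open>S\<close> that act trivially on \<open>S\<close>
  are sums, and their multiplicative inverses are negatives. So the multiplicativity of
  \<open>b \<mapsto> \<lambda>\<^sub>b\<close> yields closure under the additive operations.\<close>

lemma subgroup_lam_trivial_on:
  assumes S: "subgroup S (add_monoid A)"
  shows "subgroup {b \<in> S. \<forall>c\<in>S. lam A b c = c} (add_monoid A)"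
proof -
  have SA: "s \<in> carrier A" if "s \<in> S" for s
    using subgroup.subset[OF S] that by auto
  have neg: "\<ominus> s \<in> S" if "s \<in> S" for s
    using subgroup.m_inv_closed[OF S that] by (simp add: a_inv_def)
  have add: "s \<oplus> t \<in> S" if "s \<in> S" "t \<in> S" for s t
    using subgroup.m_closed[OF S that] by simp
  have zero: "\<zero> \<in> S"
    using subgroup.one_closed[OF S] by simp
  show ?thesis
  proof (rule add.subgroupI)
    fix b assume b: "b \<in> {b \<in> S. \<forall>c\<in>S. lam A b c = c}"
    have "b \<otimes> \<ominus> b = \<one>"
      using b neg[of b] SA by (simp add: mult_eq_add_lam r_neg zero_eq_one)
    then have inv: "\<ominus> b \<otimes> b = \<one>"
      using b SA by (simp add: inv_comm)
    have "lam A (\<ominus> b) c = c" if c: "c \<in> S" for c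
    proof -
      have "c = lam A (\<ominus> b \<otimes> b) c"
        using c SA inv by (simp add: lam_zero_left zero_eq_one[symmetric])
      also have "\<dots> = lam A (\<ominus> b) c"
        using b c SA by (simp add: lam_mult)
      finally show ?thesis by simp
    qed
    then show "\<ominus> b \<in> {b \<in> S. \<forall>c\<in>S. lam A b c = c}"
      using b neg by simp
  next
    fix b b' assume b: "b \<in> {b \<in> S. \<forall>c\<in>S. lam A b c = c}" "b' \<in> {b \<in> S. \<forall>c\<in>S. lam A b c = c}"
    then have "b \<oplus> b' = b \<otimes> b'"
      using SA by (simp add: mult_eq_add_lam)
    moreover have "b \<oplus> b' \<in> S"
      using b add by simp
    ultimately show "b \<oplus> b' \<in> {b \<in> S. \<forall>c\<in>S. lam A b c = c}"
      using b SA by (simp add: lam_mult)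
  qed (use zero SA in \<open>auto simp: lam_zero_left\<close>)
qed

text \<open>Triviality on generators spreads to the additive span in the right argument first, since each
  \<open>\<lambda>\<^sub>b\<close> is additive. Only then does \<open>subgroup_lam_trivial_on\<close>, which needs an action on a
  whole subgroup, spread it in the left argument.\<close>

lemma lam_trivial_on_generate:
  assumes B: "B \<subseteq> carrier A" and triv: "\<And>b c. \<lbrakk>b \<in> B; c \<in> B\<rbrakk> \<Longrightarrow> lam A b c = c"
    and a: "a \<in> generate (add_monoid A) B" and b: "b \<in> generate (add_monoid A) B"
  shows "lam A a b = b"
proof -
  let ?S = "generate (add_monoid A) B"
  have S: "subgroup ?S (add_monoid A)"
    using B by (simp add: add.generate_is_subgroup)
  have "?S \<subseteq> {c \<in> carrier A. lam A b c = c}" if "b \<in> B" for b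
    by (rule add.generate_subgroup_incl[OF _ subgroup_lam_fixed]) (use B triv that in auto)
  then have "B \<subseteq> {b \<in> ?S. \<forall>c\<in>?S. lam A b c = c}"
    by (auto intro: generate.incl)
  from add.generate_subgroup_incl[OF this subgroup_lam_trivial_on[OF S]]
  show ?thesis using a b by blast
qed

lemma subbrace_if_lam_trivial:
  assumes S: "subgroup S (add_monoid A)"
    and triv: "\<And>a b. \<lbrakk>a \<in> S; b \<in> S\<rbrakk> \<Longrightarrow> lam A a b = b"
  shows "subbrace S A"
proof -
  have SA: "S \<subseteq> carrier A"
    using subgroup.subset[OF S] by simp
  have neg: "\<ominus> s \<in> S" if "s \<in> S" for s
    using subgroup.m_inv_closed[OF S that] by (simp add: a_inv_def)
  have mult: "s \<otimes> t = s \<oplus> t" if "s \<in> S" "t \<in> S" for s t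
    using that SA triv by (simp add: mult_eq_add_lam subset_iff)
  have "subgroup S A"
  proof (rule subgroupI)
    fix s assume s: "s \<in> S"
    have "\<ominus> s \<otimes> s = \<one>"
      using s neg SA by (auto simp: mult l_neg zero_eq_one[symmetric])
    then have "inv s = \<ominus> s"
      using s SA by (auto intro: inv_equality)
    then show "inv s \<in> S" using neg[OF s] by simp
  next
    fix s t assume "s \<in> S" "t \<in> S"
    then show "s \<otimes> t \<in> S"
      using subgroup.m_closed[OF S] by (simp add: mult)
  qed (use SA subgroup.one_closed[OF S] in auto)
  then show ?thesis using S by (simp add: subbrace_def)
qed

lemma lam_closed_ideal:
  assumes I: "brace_ideal I A" and a: "a \<in> carrier A" and x: "x \<in> I"
  shows "lam A a x \<in> I"
proof -
  have S: "subgroup I (add_monoid A)"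
    using I by (simp add: brace_ideal_def subbrace_def)
  have xA: "x \<in> carrier A"
    using subgroup.subset[OF S] x by auto
  have "star A a x \<in> I"
    using I a x by (simp add: brace_ideal_def)
  then have "star A a x \<oplus> x \<in> I"
    using subgroup.m_closed[OF S] x by simp
  moreover have "star A a x \<oplus> x = lam A a x"
    using a xA by (simp add: star_eq_lam_minus a_minus_def a_assoc l_neg)
  ultimately show ?thesis by simp
qed

lemma abelian_left_braceI:
  assumes "\<And>a b. \<lbrakk>a \<in> carrier A; b \<in> carrier A\<rbrakk> \<Longrightarrow> lam A a b = b"
  shows "abelian_left_brace A"
  using assms left_brace_axioms
  by (simp add: abelian_left_brace_def star_eq_lam_minus a_minus_def r_neg)

end

lemma abelian_left_brace_mult:
  fixes A (structure)
  assumes "abelian_left_brace A" "a \<in> carrier A" "b \<in> carrier A"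
  shows "a \<otimes> b = a \<oplus> b"
proof -
  interpret left_brace A using assms by (simp add: abelian_left_brace_def)
  have "lam A a b \<ominus> b = \<zero>"
    using assms by (simp add: abelian_left_brace_def star_eq_lam_minus)
  then show ?thesis
    using assms eq_if_minus_eq_zero[of "lam A a b" b] by (simp add: mult_eq_add_lam)
qed

section \<open>Spans of basis elements in a free abelian group\<close>

lemma generate_free_Abelian_group:
  assumes "Y \<subseteq> X"
  shows "generate (free_Abelian_group X) (frag_of ` Y) = {c. Poly_Mapping.keys c \<subseteq> Y}"
proof
  interpret F: group "free_Abelian_group X" by simp
  have "subgroup {c. Poly_Mapping.keys c \<subseteq> Y} (free_Abelian_group X)"
    using assms by (intro F.subgroupI) (auto dest: subsetD[OF keys_add])
  then show "generate (free_Abelian_group X) (frag_of ` Y) \<subseteq> {c. Poly_Mapping.keys c \<subseteq> Y}"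
    by (rule F.generate_subgroup_incl[rotated]) auto
  show "{c. Poly_Mapping.keys c \<subseteq> Y} \<subseteq> generate (free_Abelian_group X) (frag_of ` Y)"
  proof safe
    have S: "subgroup (generate (free_Abelian_group X) (frag_of ` Y)) (free_Abelian_group X)"
      using assms by (intro F.generate_is_subgroup) auto
    fix c :: "'a \<Rightarrow>\<^sub>0 int" assume "Poly_Mapping.keys c \<subseteq> Y"
    then show "c \<in> generate (free_Abelian_group X) (frag_of ` Y)"
    proof (induction c rule: frag_induction)
      case zero
      show ?case using generate.one[of "free_Abelian_group X"] by simp
    next
      case (one x)
      then show ?case by (simp add: generate.incl)
    next
      case (diff a b)
      have "Poly_Mapping.keys b \<subseteq> X"
        using subgroup.mem_carrier[OF S diff(2)] by simp
      then have "- b \<in> generate (free_Abelian_group X) (frag_of ` Y)"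
        using subgroup.m_inv_closed[OF S diff(2)] by simp
      from subgroup.m_closed[OF S diff(1) this] show ?case by simp
    qed
  qed
qed

lemma free_abelian_basis_generate:
  assumes f: "f \<in> iso (free_Abelian_group X) H" "\<And>x. x \<in> X \<Longrightarrow> f (frag_of x) = i x"
    and H: "group H" and Y: "Y \<subseteq> X"
  shows "generate H (i ` Y) = f ` {c. Poly_Mapping.keys c \<subseteq> Y}"
proof -
  interpret group_hom "free_Abelian_group X" H f
    using f(1) H by (simp add: group_hom_def group_hom_axioms_def iso_def)
  have "i ` Y = f ` frag_of ` Y"
    using f(2) Y by (force simp: image_image intro: image_cong)
  then have "generate H (i ` Y) = f ` generate (free_Abelian_group X) (frag_of ` Y)"
    using Y by (subst generate_img[symmetric]) auto
  then show ?thesis using Y by (simp add: generate_free_Abelian_group)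
qed

lemma free_abelian_basis_generates:
  assumes "free_abelian_basis i X H" "group H"
  shows "generate H (i ` X) = carrier H"
proof -
  obtain f where f: "f \<in> iso (free_Abelian_group X) H" "\<And>x. x \<in> X \<Longrightarrow> f (frag_of x) = i x"
    using assms(1) by (auto simp: free_abelian_basis_def)
  have "{c. Poly_Mapping.keys c \<subseteq> X} = carrier (free_Abelian_group X)"
    by auto
  then show ?thesis
    using free_abelian_basis_generate[OF f assms(2) order.refl] f(1)
    by (simp add: iso_def bij_betw_def)
qed

text \<open>Linear independence: a basis element outside \<open>Y\<close> is no integer combination of \<open>Y\<close>.\<close>

lemma free_abelian_basis_in_generate:
  assumes "free_abelian_basis i X H" "group H" "Y \<subseteq> X" "x \<in> X" "i x \<in> generate H (i ` Y)"
  shows "x \<in> Y"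
proof -
  obtain f where f: "f \<in> iso (free_Abelian_group X) H" "\<And>x. x \<in> X \<Longrightarrow> f (frag_of x) = i x"
    using assms(1) by (auto simp: free_abelian_basis_def)
  obtain c where c: "Poly_Mapping.keys c \<subseteq> Y" "f (frag_of x) = f c"
    using assms f(2) free_abelian_basis_generate[OF f assms(2,3)] by auto
  have "inj_on f (carrier (free_Abelian_group X))"
    using f(1) by (simp add: iso_def bij_betw_def)
  then have "frag_of x = c"
    by (rule inj_onD) (use c assms in auto)
  then show ?thesis using c(1) by auto
qed

lemma free_abelian_basis_closed:
  assumes "free_abelian_basis i X H" "x \<in> X"
  shows "i x \<in> carrier H"
proof -
  obtain f where f: "f \<in> iso (free_Abelian_group X) H" "f (frag_of x) = i x"
    using assms by (auto simp: free_abelian_basis_def)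
  then have "f (frag_of x) \<in> carrier H"
    using assms(2) by (intro hom_in_carrier[of f "free_Abelian_group X"]) (auto simp: iso_def)
  then show ?thesis using f(2) by simp
qed

section \<open>Twist solutions\<close>

text \<open>If \<open>r (x, y) = (y, z)\<close> for all \<open>x, y\<close> with some \<open>z\<close>, then
  \<open>(x, y) = r (y, z)\<close> has first component \<open>z\<close>.\<close>

lemma twist_solution_if_sol_lam_trivial:
  assumes "ybe_solution X r" and lam: "\<And>x y. \<lbrakk>x \<in> X; y \<in> X\<rbrakk> \<Longrightarrow> sol_lam r x y = y"
  shows "twist_solution X r"
proof -
  have "r (x, y) = (y, x)" if xy: "x \<in> X" "y \<in> X" for x y
  proof -
    obtain z where z: "r (x, y) = (y, z)"
      using lam[OF xy] by (cases "r (x, y)") (simp add: sol_lam_def)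
    have "r (x, y) \<in> X \<times> X" "r (r (x, y)) = (x, y)"
      using assms(1) xy by (simp_all add: ybe_solution_def)
    then have "z \<in> X" "r (y, z) = (x, y)"
      using z by simp_all
    then show ?thesis
      using lam[OF xy(2) \<open>z \<in> X\<close>] z by (simp add: sol_lam_def)
  qed
  then show ?thesis using assms(1) by (simp add: twist_solution_def)
qed

section \<open>Dedekind structure braces of square-free solutions\<close>

theorem corollary5:
  fixes X :: "'a set" and r :: "'a \<times> 'a \<Rightarrow> 'a \<times> 'a" and G :: "('a \<times> bool) list set ring"
  assumes "ybe_solution X r"
    and "is_structure_brace X r G"
    and "dedekind_left_brace G"
    and "\<And>x. x \<in> X \<Longrightarrow> r (x, x) = (x, x)"
  shows "twist_solution X r \<and>
         abelian_left_brace G \<and>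
         (\<exists>f. f \<in> brace_iso G (trivial_brace (free_Abelian_group X)))"
proof -
  let ?i = "structure_iota X r"
  interpret left_brace G
    using assms(2) by (simp add: is_structure_brace_def)
  have basis: "free_abelian_basis ?i X (add_monoid G)"
    and lam_i: "\<And>x y. \<lbrakk>x \<in> X; y \<in> X\<rbrakk> \<Longrightarrow> lam G (?i x) (?i y) = ?i (sol_lam r x y)"
    using assms(2) by (simp_all add: is_structure_brace_def)
  have i_closed: "?i x \<in> carrier G" if "x \<in> X" for x
    using free_abelian_basis_closed[OF basis that] by simp
  have sol_lam: "sol_lam r y x = x" if x: "x \<in> X" and y: "y \<in> X" for x y
  proof -
    let ?Z = "generate (add_monoid G) {?i x}"
    have Z: "subgroup ?Z (add_monoid G)"
      using i_closed[OF x] by (intro add.generate_is_subgroup) simp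
    have "lam G (?i x) (?i x) = ?i x"
      using lam_i[OF x x] assms(4)[OF x] by (simp add: sol_lam_def)
    \<comment> \<open>\<open>?Z\<close> is the cyclic group \<open>\<int>x\<close>, a subbrace because \<open>x\<close> acts trivially on itself.\<close>
    then have "subbrace ?Z G"
      using lam_trivial_on_generate[of "{?i x}"] i_closed[OF x]
      by (intro subbrace_if_lam_trivial[OF Z]) auto
    then have "brace_ideal ?Z G"
      using assms(3) by (simp add: dedekind_left_brace_def)
    then have "lam G (?i y) (?i x) \<in> ?Z"
      by (rule lam_closed_ideal) (auto intro: i_closed[OF y] generate.incl)
    then have "?i (sol_lam r y x) \<in> generate (add_monoid G) (?i ` {x})"
      using lam_i[OF y x] by simp
    moreover have "sol_lam r y x \<in> X"
      using assms(1) x y by (simp add: ybe_solution_def mem_Times_iff sol_lam_def)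
    ultimately show ?thesis
      using free_abelian_basis_in_generate[OF basis add.is_group, of "{x}"] x by blast
  qed
  have twist: "twist_solution X r"
    using twist_solution_if_sol_lam_trivial[OF assms(1)] sol_lam by blast
  have "lam G a b = b" if "a \<in> carrier G" "b \<in> carrier G" for a b
    by (rule lam_trivial_on_generate[of "?i ` X"])
      (use that i_closed lam_i sol_lam free_abelian_basis_generates[OF basis add.is_group] in auto)
  then have abelian: "abelian_left_brace G"
    by (rule abelian_left_braceI)
  obtain f where "f \<in> iso (free_Abelian_group X) (add_monoid G)"
    using basis by (auto simp: free_abelian_basis_def)
  then obtain g where g: "g \<in> iso (add_monoid G) (free_Abelian_group X)"
    using group.iso_set_sym[OF group_free_Abelian_group] by blast
  then have "g \<in> brace_iso G (trivial_brace (free_Abelian_group X))"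
    by (simp add: brace_iso_def iso_def hom_def trivial_brace_def
        abelian_left_brace_mult[OF abelian])
  then show ?thesis using twist abelian by blast
qed

end
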